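(* Let $n\ge 1$ be an integer. A segmented permutation of $[n]=\{1,\dots,n\}$ is a permutation $\sigma=\sigma_1\sigma_2\cdots\sigma_n$ of $[n]$ together with a choice, for each of the $n-1$ slots between consecutive letters $\sigma_i,\sigma_{i+1}$ ($1\le i\le n-1$), of whether or not a bar is placed in that slot; let $\mathcal{SP}_n$ denote the set of segmented permutations of $[n]$. For $\sigma\in\mathcal{SP}_n$, a position $i\in[n-1]$ is a descent of $\sigma$ if $\sigma_i>\sigma_{i+1}$ and there is no bar in the slot between $\sigma_i$ and $\sigma_{i+1}$; let $\mathrm{des}(\sigma)$ be the number of descents and $\mathrm{seg}(\sigma)$ the number of bars of $\sigma$. Define $$T(n,k)=|\{\sigma\in\mathcal{SP}_n:\mathrm{des}(\sigma)=k\}|,\qquad K(n,i,j)=|\{\sigma\in\mathcal{SP}_n:\mathrm{des}(\sigma)=i,\ \mathrm{seg}(\sigma)=j\}|,$$ and $$P_n(t)=\sum_{k=0}^{n-1}T(n,k)t^k,\qquad K_{n,j}(x)=\sum_{i=0}^{n-1-j}K(n,i,j)x^i,\qquad L_{n,i}(x)=\sum_{j=0}^{n-1-i}K(n,i,j)x^j.$$ Then for all integers $0\le i,j\le n-1$, the polynomials $P_n(t)$, $K_{n,j}(x)$ and $L_{n,i}(x)$ have only real zeros. *)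

theory Defs
  imports Complex_Main
    "HOL-Combinatorics.Permutations"
    "HOL-Computational_Algebra.Polynomial"
begin

text \<open>
  A segmented permutation is a pair \<open>(\<sigma>, B)\<close>: \<open>\<sigma>\<close> is the permutation, whose letters are
  \<open>\<sigma> 1, \<dots>, \<sigma> n\<close>, and \<open>B\<close> is the set of barred slots, slot \<open>i\<close> lying between
  \<open>\<sigma> i\<close> and \<open>\<sigma> (i + 1)\<close>. Since \<open>permutes\<close> fixes every point outside
  \<open>{1..n}\<close>, each segmented permutation is represented by exactly one pair.
\<close>

definition SP :: "nat \<Rightarrow> ((nat \<Rightarrow> nat) \<times> nat set) set" where
  "SP n = {(\<sigma>, B). \<sigma> permutes {1..n} \<and> B \<subseteq> {1..n - 1}}"

definition des :: "nat \<Rightarrow> (nat \<Rightarrow> nat) \<times> nat set \<Rightarrow> nat" where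
  "des n s = card {i \<in> {1..n - 1}. fst s i > fst s (i + 1) \<and> i \<notin> snd s}"

definition seg :: "(nat \<Rightarrow> nat) \<times> nat set \<Rightarrow> nat" where
  "seg s = card (snd s)"

definition T :: "nat \<Rightarrow> nat \<Rightarrow> nat" where
  "T n k = card {s \<in> SP n. des n s = k}"

definition K :: "nat \<Rightarrow> nat \<Rightarrow> nat \<Rightarrow> nat" where
  "K n i j = card {s \<in> SP n. des n s = i \<and> seg s = j}"

definition P_poly :: "nat \<Rightarrow> real poly" where
  "P_poly n = (\<Sum>k = 0..n - 1. monom (of_nat (T n k)) k)"

definition K_poly :: "nat \<Rightarrow> nat \<Rightarrow> real poly" where
  "K_poly n j = (\<Sum>i = 0..n - 1 - j. monom (of_nat (K n i j)) i)"

definition L_poly :: "nat \<Rightarrow> nat \<Rightarrow> real poly" where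
  "L_poly n i = (\<Sum>j = 0..n - 1 - i. monom (of_nat (K n i j)) j)"

text \<open>
  Nonzero constants satisfy this vacuously; the zero polynomial does not satisfy it.
\<close>

definition only_real_zeros :: "real poly \<Rightarrow> bool" where
  "only_real_zeros p \<longleftrightarrow> (\<forall>z::complex. poly (map_poly of_real p) z = 0 \<longrightarrow> z \<in> \<real>)"

lemma finite_SP: "finite (SP n)"
proof -
  have "SP n = {\<sigma>. \<sigma> permutes {1..n}} \<times> Pow {1..n - 1}"
    by (auto simp: SP_def)
  then show ?thesis
    by (simp add: finite_permutations)
qed

end

theory Submission
  imports Defs
    "HOL-Combinatorics.Multiset_Permutations"
    "HOL-Computational_Algebra.Fundamental_Theorem_Algebra"
begin

text \<open>
  Summing over the bars first, \<open>\<Sum> x\<^bsup>des\<^esup> y\<^bsup>seg\<^esup>\<close> becomes the homogenised Eulerian polynomial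
  evaluated at \<open>(x + y, 1 + y)\<close>. The Eulerian polynomial is a product of factors \<open>t + r\<^sub>k\<close> with
  \<open>r\<^sub>k \<ge> 0\<close>, so the generating function is \<open>\<Prod>\<^sub>k ((x + r\<^sub>k) + (1 + r\<^sub>k) y)\<close>. Setting \<open>y = 1\<close> settles
  \<open>P\<^sub>n\<close>. If one variable is fixed in the open upper half-plane, then as a polynomial in the other
  variable all zeros lie in the open lower half-plane; by Gauss--Lucas so do those of all derivatives,
  whose values at \<open>0\<close>, the coefficients up to factorials, therefore do not vanish.
\<close>

section \<open>Descents of lists and insertion of a new maximum\<close>

fun list_des :: "'a::linorder list \<Rightarrow> nat" where
  "list_des (a # b # xs) = (if a > b then 1 else 0) + list_des (b # xs)"
| "list_des _ = 0"

definition insert_at :: "nat \<Rightarrow> 'a \<Rightarrow> 'a list \<Rightarrow> 'a list" where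
  "insert_at p x xs = take p xs @ x # drop p xs"

lemma insert_at_0 [simp]: "insert_at 0 x xs = x # xs"
  and insert_at_Nil [simp]: "insert_at p x [] = [x]"
  and insert_at_Suc_Cons [simp]: "insert_at (Suc p) x (y # ys) = y # insert_at p x ys"
  by (simp_all add: insert_at_def)

text \<open>The end slot and the descent slots take in \<open>M\<close> without changing the descent
  count, while each remaining slot gains one descent. The slot before \<open>a\<close> is left out
  so that the induction can peel off the head.\<close>

lemma sum_list_des_Cons_insert_max:
  fixes t :: "'b::comm_ring_1"
  assumes "\<forall>x\<in>set (a # xs). x < M"
  shows "(\<Sum>p\<le>length xs. t ^ list_des (a # insert_at p M xs)) =
    (of_nat (list_des (a # xs)) + 1) * t ^ list_des (a # xs) +
    (of_nat (length xs) - of_nat (list_des (a # xs))) * t ^ Suc (list_des (a # xs))"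
  using assms
proof (induction xs arbitrary: a)
  case Nil
  then show ?case by auto
next
  case (Cons b xs)
  have M: "a < M" "b < M" using Cons.prems by auto
  have "(\<Sum>p\<le>length (b # xs). t ^ list_des (a # insert_at p M (b # xs))) =
    t ^ list_des (a # M # b # xs) +
    (\<Sum>p\<le>length xs. t ^ list_des (a # b # insert_at p M xs))"
    by (simp add: sum.atMost_Suc_shift del: list_des.simps sum.atMost_Suc)
  also have "(\<Sum>p\<le>length xs. t ^ list_des (a # b # insert_at p M xs)) =
    t ^ (if a > b then 1 else 0) * (\<Sum>p\<le>length xs. t ^ list_des (b # insert_at p M xs))"
    by (simp add: power_add sum_distrib_left)
  also have "(\<Sum>p\<le>length xs. t ^ list_des (b # insert_at p M xs)) =
    (of_nat (list_des (b # xs)) + 1) * t ^ list_des (b # xs) +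
    (of_nat (length xs) - of_nat (list_des (b # xs))) * t ^ Suc (list_des (b # xs))"
    using Cons.prems by (intro Cons.IH) auto
  finally show ?case
    using M by (auto simp: algebra_simps)
qed

text \<open>On a nonempty list the front slot creates one further descent, which raises the second
  coefficient by one.\<close>

lemma sum_list_des_insert_max:
  fixes t :: "'b::comm_ring_1"
  assumes "\<forall>x\<in>set xs. x < M"
  shows "(\<Sum>p\<le>length xs. t ^ list_des (insert_at p M xs)) =
    (of_nat (list_des xs) + 1) * t ^ list_des xs +
    (of_nat (length xs) - of_nat (list_des xs)) * t ^ Suc (list_des xs)"
proof (cases xs)
  case (Cons a ys)
  have "(\<Sum>p\<le>length xs. t ^ list_des (insert_at p M xs)) =
    t ^ Suc (list_des xs) + (\<Sum>p\<le>length ys. t ^ list_des (a # insert_at p M ys))"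
    using assms by (simp add: Cons sum.atMost_Suc_shift del: sum.atMost_Suc)
  then show ?thesis
    using sum_list_des_Cons_insert_max[of a ys M t] assms
    by (simp add: Cons algebra_simps)
qed auto

text \<open>The inverse map deletes the letter \<open>Suc n\<close> and records its
  position.\<close>

lemma bij_betw_insert_at:
  "bij_betw (\<lambda>(xs, p). insert_at p (Suc n) xs)
     (permutations_of_set {1..n} \<times> {..n}) (permutations_of_set {1..Suc n})"
proof (rule bij_betwI')
  fix u v
  assume u: "u \<in> permutations_of_set {1..n} \<times> {..n}"
    and v: "v \<in> permutations_of_set {1..n} \<times> {..n}"
  obtain xs p ys q where uv: "u = (xs, p)" "v = (ys, q)" by (metis surj_pair)
  have xs: "Suc n \<notin> set xs" "p \<le> length xs" and ys: "Suc n \<notin> set ys" "q \<le> length ys"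
    using u v uv by (auto dest: permutations_of_setD simp: length_finite_permutations_of_set)
  have "xs = ys \<and> p = q" if eq: "insert_at p (Suc n) xs = insert_at q (Suc n) ys"
  proof -
    have notin: "Suc n \<notin> set (take p xs)" "Suc n \<notin> set (take q ys)"
      "Suc n \<notin> set (drop p xs)" "Suc n \<notin> set (drop q ys)"
      using xs ys by (auto dest: in_set_takeD in_set_dropD)
    \<comment> \<open>The letter \<open>Suc n\<close> occurs exactly once on each side, so the
      splitting around it is unique; comparing lengths of the prefixes then gives
      \<open>p = q\<close>.\<close>
    have "take p xs = take q ys \<and> drop p xs = drop q ys"
      using eq notin unfolding insert_at_def by (metis append_Cons_eq_iff)
    then show ?thesis
      using xs(2) ys(2) by (metis append_take_drop_id length_take min.absorb2)
  qed
  then show "((case u of (xs, p) \<Rightarrow> insert_at p (Suc n) xs) =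
      (case v of (xs, p) \<Rightarrow> insert_at p (Suc n) xs)) = (u = v)"
    by (auto simp: uv)
next
  fix u assume "u \<in> permutations_of_set {1..n} \<times> {..n}"
  then obtain xs p where u: "u = (xs, p)" "set xs = {1..n}" "distinct xs"
    by (auto dest: permutations_of_setD)
  have "mset (insert_at p (Suc n) xs) = mset (Suc n # xs)"
    by (metis insert_at_def append_take_drop_id mset.simps(2) mset_append union_mset_add_mset_right)
  then have "set (insert_at p (Suc n) xs) = set (Suc n # xs)"
    "distinct (insert_at p (Suc n) xs) = distinct (Suc n # xs)"
    by (metis set_mset_mset, metis mset_eq_imp_distinct_iff)
  then show "(case u of (xs, p) \<Rightarrow> insert_at p (Suc n) xs) \<in> permutations_of_set {1..Suc n}"
    using u by (intro permutations_of_setI) (auto simp: atLeastAtMostSuc_conv)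
next
  fix zs assume "zs \<in> permutations_of_set {1..Suc n}"
  then have zs: "set zs = {1..Suc n}" "distinct zs" by (auto dest: permutations_of_setD)
  then obtain as bs where split: "zs = as @ Suc n # bs"
    by (metis atLeastAtMost_iff le_add1 plus_1_eq_Suc order_refl split_list)
  have "set (as @ bs) = {1..Suc n} - {Suc n}" using zs split by auto
  then have perm: "as @ bs \<in> permutations_of_set {1..n}"
    using zs split by (intro permutations_of_setI) (auto simp: atLeastAtMostSuc_conv)
  then have "length (as @ bs) = n"
    using length_finite_permutations_of_set by fastforce
  then have "(as @ bs, length as) \<in> permutations_of_set {1..n} \<times> {..n}"
    using perm by auto
  moreover have "zs = insert_at (length as) (Suc n) (as @ bs)"
    by (simp add: insert_at_def split)
  ultimately show "\<exists>u\<in>permutations_of_set {1..n} \<times> {..n}.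
      zs = (case u of (xs, p) \<Rightarrow> insert_at p (Suc n) xs)"
    by (intro bexI[of _ "(as @ bs, length as)"]) auto
qed

section \<open>Eulerian polynomials and their recurrence\<close>

text \<open>The normalisation with constant term 1, taken over the complex numbers so that the
  fundamental theorem of algebra applies.\<close>

definition eulerian_poly :: "nat \<Rightarrow> complex poly" where
  "eulerian_poly n = (\<Sum>xs\<in>permutations_of_set {1..n}. [:0, 1:] ^ list_des xs)"

lemma eulerian_poly_1 [simp]: "eulerian_poly (Suc 0) = 1"
  by (simp add: eulerian_poly_def)

text \<open>Each permutation of \<open>{1..Suc n}\<close> is an insertion into one of
  \<open>{1..n}\<close>. The resulting weights \<open>d + 1\<close> and \<open>n - d\<close> are
  linear in the descent count \<open>d\<close>, and multiplying \<open>t ^ d\<close> by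
  \<open>d\<close> is the action of \<open>t\<close> times the derivative.\<close>

lemma eulerian_poly_Suc:
  "eulerian_poly (Suc n) =
     [:1, of_nat n:] * eulerian_poly n + [:0, 1, -1:] * pderiv (eulerian_poly n)"
proof -
  let ?X = "[:0, 1:] :: complex poly"
  have X: "[:1, of_nat n:] = 1 + of_nat n * ?X" "[:0, 1, -1:] = ?X * (1 - ?X)"
    by (simp_all add: of_nat_poly one_pCons)
  have "eulerian_poly (Suc n) =
    (\<Sum>(xs, p)\<in>permutations_of_set {1..n} \<times> {..n}. ?X ^ list_des (insert_at p (Suc n) xs))"
    unfolding eulerian_poly_def
    by (subst sum.reindex_bij_betw[OF bij_betw_insert_at, symmetric]) (simp add: case_prod_unfold)
  also have "\<dots> = (\<Sum>xs\<in>permutations_of_set {1..n}. \<Sum>p\<le>n. ?X ^ list_des (insert_at p (Suc n) xs))"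
    by (simp add: sum.cartesian_product)
  also have "\<dots> = (\<Sum>xs\<in>permutations_of_set {1..n}.
    [:1, of_nat n:] * ?X ^ list_des xs + [:0, 1, -1:] * pderiv (?X ^ list_des xs))"
  proof (rule sum.cong[OF refl])
    fix xs assume "xs \<in> permutations_of_set {1..n}"
    then have xs: "\<forall>x\<in>set xs. x < Suc n" "length xs = n"
      by (auto dest: permutations_of_setD simp: length_finite_permutations_of_set)
    have d: "?X * pderiv (?X ^ k) = of_nat k * ?X ^ k" for k
      by (cases k) (simp_all add: pderiv_power_Suc pderiv_pCons of_nat_poly del: power_Suc,
          simp add: algebra_simps)
    have "(\<Sum>p\<le>n. ?X ^ list_des (insert_at p (Suc n) xs)) =
      (of_nat (list_des xs) + 1) * ?X ^ list_des xs +
      (of_nat n - of_nat (list_des xs)) * ?X ^ Suc (list_des xs)"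
      using sum_list_des_insert_max[OF xs(1), of ?X] xs(2) by simp
    also have "\<dots> = (1 + of_nat n * ?X) * ?X ^ list_des xs +
      (1 - ?X) * (of_nat (list_des xs) * ?X ^ list_des xs)"
      unfolding power_Suc by algebra
    finally show "(\<Sum>p\<le>n. ?X ^ list_des (insert_at p (Suc n) xs)) =
      [:1, of_nat n:] * ?X ^ list_des xs + [:0, 1, -1:] * pderiv (?X ^ list_des xs)"
      unfolding X d[symmetric] by (simp only: ac_simps)
  qed
  finally show ?thesis
    by (simp add: eulerian_poly_def sum.distrib sum_distrib_left higher_pderiv_sum[of 1, simplified])
qed

section \<open>Passage from lists to permutations as functions\<close>

lemma list_des_map_upt:
  "list_des (map f [m..<m + k]) = card {i \<in> {m..<m + k - 1}. f i > f (i + 1)}"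
proof (induction k arbitrary: m)
  case (Suc k)
  show ?case
  proof (cases k)
    case (Suc l)
    have "{i \<in> {m..<m + Suc k - 1}. f i > f (i + 1)} =
      (if f m > f (m + 1) then {m} else {}) \<union> {i \<in> {Suc m..<Suc m + k - 1}. f i > f (i + 1)}"
      using Suc by (auto simp: le_eq_less_or_eq Suc_le_eq)
    also have "card \<dots> = (if f m > f (m + 1) then 1 else 0) +
      card {i \<in> {Suc m..<Suc m + k - 1}. f i > f (i + 1)}"
      by (subst card_Un_disjoint) auto
    finally have card: "card {i \<in> {m..<m + Suc k - 1}. f i > f (i + 1)} = \<dots>" .
    have upt: "[m..<m + Suc k] = m # Suc m # [Suc (Suc m)..<Suc m + k]"
      "[Suc m..<Suc m + k] = Suc m # [Suc (Suc m)..<Suc m + k]"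
      using Suc by (simp_all add: upt_conv_Cons del: upt_Suc)
    show ?thesis
      unfolding card Suc.IH[symmetric] upt by simp
  qed auto
qed auto

lemma bij_betw_map_permutes:
  "bij_betw (\<lambda>\<sigma>. map \<sigma> [1..<Suc n]) {\<sigma>. \<sigma> permutes {1..n}} (permutations_of_set {1..n})"
proof -
  let ?f = "\<lambda>\<sigma>::nat \<Rightarrow> nat. map \<sigma> [1..<Suc n]"
  have inj: "inj_on ?f {\<sigma>. \<sigma> permutes {1..n}}"
  proof (rule inj_onI, rule ext)
    fix \<sigma> \<tau> x
    assume "\<sigma> \<in> {\<sigma>. \<sigma> permutes {1..n}}" "\<tau> \<in> {\<sigma>. \<sigma> permutes {1..n}}" "?f \<sigma> = ?f \<tau>"
    then show "\<sigma> x = \<tau> x"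
      by (cases "x \<in> {1..n}") (auto simp: permutes_not_in simp del: upt_Suc)
  qed
  have "?f ` {\<sigma>. \<sigma> permutes {1..n}} \<subseteq> permutations_of_set {1..n}"
  proof safe
    fix \<sigma> assume s: "\<sigma> permutes {1..n}"
    have "set (?f \<sigma>) = \<sigma> ` {1..n}"
      by (simp add: atLeastLessThanSuc_atLeastAtMost del: upt_Suc)
    then show "?f \<sigma> \<in> permutations_of_set {1..n}"
      using s by (intro permutations_of_setI)
        (simp_all add: permutes_image distinct_map permutes_inj_on del: upt_Suc)
  qed
  \<comment> \<open>Surjectivity follows from injectivity by counting: both sets have
    \<open>fact n\<close> elements.\<close>
  then have "?f ` {\<sigma>. \<sigma> permutes {1..n}} = permutations_of_set {1..n}"
    using card_permutations[of "{1..n}" n] card_image[OF inj]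
    by (intro card_subset_eq) (simp_all del: upt_Suc)
  with inj show ?thesis by (simp add: bij_betw_def)
qed

lemma poly_eulerian_poly:
  "poly (eulerian_poly n) z =
     (\<Sum>\<sigma> | \<sigma> permutes {1..n}. z ^ card {i \<in> {1..n - 1}. \<sigma> i > \<sigma> (i + 1)})"
proof -
  have "list_des (map \<sigma> [1..<Suc n]) = card {i \<in> {1..n - 1}. \<sigma> i > \<sigma> (i + 1)}" for \<sigma> :: "nat \<Rightarrow> nat"
    using list_des_map_upt[of \<sigma> 1 n]
    by (cases n) (simp_all add: atLeastLessThanSuc_atLeastAtMost del: upt_Suc)
  then show ?thesis
    unfolding eulerian_poly_def
    by (subst sum.reindex_bij_betw[OF bij_betw_map_permutes, symmetric])
      (simp add: poly_sum del: upt_Suc)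
qed

section \<open>Logarithmic derivatives and zeros in a half-plane\<close>

text \<open>The logarithmic derivative of a product, needed both for Gauss--Lucas and for the
  Eulerian recurrence.\<close>

lemma poly_pderiv_prod_linear:
  fixes w :: "'b \<Rightarrow> 'a::field"
  assumes "finite A" "\<And>k. k \<in> A \<Longrightarrow> z + w k \<noteq> 0"
  shows "poly (pderiv (\<Prod>k\<in>A. [:w k, 1:])) z =
    poly (\<Prod>k\<in>A. [:w k, 1:]) z * (\<Sum>k\<in>A. 1 / (z + w k))"
proof -
  have "poly (pderiv (\<Prod>k\<in>A. [:w k, 1:])) z = (\<Sum>k\<in>A. \<Prod>l\<in>A - {k}. z + w l)"
    by (simp add: pderiv_prod poly_sum poly_prod pderiv_pCons add.commute)
  also have "\<dots> = (\<Sum>k\<in>A. (\<Prod>l\<in>A. z + w l) * (1 / (z + w k)))"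
    using assms by (intro sum.cong) (auto simp: prod.remove field_simps)
  finally show ?thesis
    by (simp add: sum_distrib_left poly_prod add.commute)
qed

text \<open>Gauss--Lucas for a half-plane: every root \<rho> lies strictly below the real axis, so
  each \<open>1 / (z - \<rho>)\<close> has negative imaginary part. Positive degree makes their sum
  nonempty, hence nonzero.\<close>

lemma pderiv_nonzero_upper_half_plane:
  fixes p :: "complex poly"
  assumes p: "\<And>z. Im z \<ge> 0 \<Longrightarrow> poly p z \<noteq> 0" and deg: "degree p > 0" and z: "Im z \<ge> 0"
  shows "poly (pderiv p) z \<noteq> 0"
proof -
  obtain \<rho> where "smult (lead_coeff p) (\<Prod>i<degree p. [:- \<rho> i, 1:]) = p"
    by (rule complex_poly_decompose')
  then obtain c where c: "p = smult c (\<Prod>i<degree p. [:- \<rho> i, 1:])"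
    by metis
  have root: "Im (\<rho> i) < 0" if "i < degree p" for i
  proof -
    have "poly p (\<rho> i) = 0"
      by (subst c) (use that in \<open>auto simp: poly_prod\<close>)
    then show ?thesis using p[of "\<rho> i"] by force
  qed
  have "z + - \<rho> i \<noteq> 0" if "i < degree p" for i
    using root[OF that] z by (auto simp: complex_eq_iff)
  then have eq: "poly (pderiv p) z = poly p z * (\<Sum>i<degree p. 1 / (z + - \<rho> i))"
    using poly_pderiv_prod_linear[of "{..<degree p}" z "\<lambda>i. - \<rho> i"]
    by (subst (1 2) c) (simp add: pderiv_smult del: add_uminus_conv_diff)
  have "Im (1 / (z + - \<rho> i)) < 0" if "i < degree p" for i
  proof -
    have "Im (z + - \<rho> i) > 0" using root[OF that] z by simp
    moreover from this have "(Re (z + - \<rho> i))\<^sup>2 + (Im (z + - \<rho> i))\<^sup>2 > 0"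
      by (simp add: sum_power2_gt_zero_iff)
    ultimately show ?thesis by (simp add: Im_divide divide_neg_pos)
  qed
  then have "(\<Sum>i<degree p. - Im (1 / (z + - \<rho> i))) > 0"
    using deg by (intro sum_pos) (auto simp del: add_uminus_conv_diff)
  then have "(\<Sum>i<degree p. 1 / (z + - \<rho> i)) \<noteq> 0"
    by (metis Im_sum less_irrefl minus_zero sum_negf zero_complex.sel(2))
  with eq p[OF z] show ?thesis by simp
qed

text \<open>Iterating Gauss--Lucas keeps the \<open>j\<close>-th derivative free of zeros in the
  half-plane, and its value at 0 is a factorial multiple of \<open>coeff p j\<close>. The half-plane
  is closed so that it contains 0.\<close>

lemma coeff_nonzero_upper_half_plane:
  fixes p :: "complex poly"
  assumes p: "\<And>z. Im z \<ge> 0 \<Longrightarrow> poly p z \<noteq> 0" and j: "j \<le> degree p"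
  shows "coeff p j \<noteq> 0"
proof -
  have "\<forall>z. Im z \<ge> 0 \<longrightarrow> poly ((pderiv ^^ j) p) z \<noteq> 0"
    using j
  proof (induction j)
    case (Suc j)
    then show ?case
      using pderiv_nonzero_upper_half_plane[of "(pderiv ^^ j) p"]
      by (simp add: degree_higher_pderiv)
  qed (use p in simp)
  then have "coeff ((pderiv ^^ j) p) 0 \<noteq> 0"
    by (metis order_refl poly_0_coeff_0 zero_complex.sel(2))
  then show ?thesis
    by (auto simp: coeff_higher_pderiv)
qed

text \<open>Each factor vanishes only at \<open>- w k / c k\<close>, below the real axis, and the
  nonzero slopes make the degree exactly \<open>m\<close>.\<close>

lemma coeff_prod_linear_nonzero:
  fixes w :: "nat \<Rightarrow> complex" and c :: "nat \<Rightarrow> real"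
  assumes "\<And>k. k < m \<Longrightarrow> Im (w k) > 0" "\<And>k. k < m \<Longrightarrow> c k > 0" "j \<le> m"
  shows "coeff (\<Prod>k<m. [:w k, of_real (c k):]) j \<noteq> 0"
proof (rule coeff_nonzero_upper_half_plane)
  fix z :: complex assume z: "Im z \<ge> 0"
  have "w k + z * of_real (c k) \<noteq> 0" if "k < m" for k
  proof -
    have "Im (w k + z * of_real (c k)) > 0"
      using assms(1,2)[OF that] z by (simp add: add_pos_nonneg)
    then show ?thesis by force
  qed
  then show "poly (\<Prod>k<m. [:w k, of_real (c k):]) z \<noteq> 0"
    by (simp add: poly_prod)
next
  have "degree (\<Prod>k<m. [:w k, of_real (c k):]) = (\<Sum>k<m. degree [:w k, complex_of_real (c k):])"
    using assms(2) by (intro degree_prod_sum_eq) force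
  also have "\<dots> = (\<Sum>k<m. 1)"
    using assms(2) by (intro sum.cong) force+
  finally show "j \<le> degree (\<Prod>k<m. [:w k, of_real (c k):])"
    using assms(3) by simp
qed

section \<open>Real-rootedness of the Eulerian polynomials\<close>

text \<open>
  If \<open>A(t) = \<Prod>\<^sub>k (t + r\<^sub>k)\<close> is one Eulerian polynomial, the next one divided by \<open>t A(t)\<close> is
  \<open>1 + 1 / t + \<Sum>\<^sub>k (1 + r\<^sub>k) / (t + r\<^sub>k)\<close>. Off the real axis its imaginary part has the sign opposite to
  that of \<open>t\<close>, and on the positive axis it is positive.
\<close>

lemma eulerian_poly_real_zeros:
  "\<exists>r. (\<forall>k<m. r k \<ge> 0) \<and> eulerian_poly (Suc m) = (\<Prod>k<m. [:complex_of_real (r k), 1:])"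
proof (induction m)
  case (Suc m)
  then obtain r where r: "\<And>k. k < m \<Longrightarrow> r k \<ge> 0"
    and A: "eulerian_poly (Suc m) = (\<Prod>k<m. [:complex_of_real (r k), 1:])"
    by blast
  define A where "A = eulerian_poly (Suc m)"
  define B where "B = eulerian_poly (Suc (Suc m))"
  have B: "B = [:1, of_nat (Suc m):] * A + [:0, 1, -1:] * pderiv A"
    unfolding A_def B_def by (rule eulerian_poly_Suc)
  have degA: "degree A = m"
    unfolding A_def A by (subst degree_prod_sum_eq) auto
  have leadA: "coeff A m = 1"
    using lead_coeff_prod[of "\<lambda>k. [:complex_of_real (r k), 1:]" "{..<m}"]
    by (simp flip: A add: A_def[symmetric] degA)
  \<comment> \<open>The triangular recurrence of the Eulerian numbers; it shows that
    \<open>B\<close> is monic of degree \<open>Suc m\<close>.\<close>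
  have coeffB: "coeff B (Suc k) =
      of_nat (k + 2) * coeff A (Suc k) + (of_nat (Suc m) - of_nat k) * coeff A k" for k
    by (cases k) (simp_all add: B coeff_pderiv algebra_simps)
  have leadB: "coeff B (Suc m) = 1"
    using leadA degA by (simp add: coeffB coeff_eq_0)
  have "degree B \<le> Suc m"
  proof (rule degree_le, safe)
    fix k assume "Suc m < k"
    then show "coeff B k = 0"
      using degA by (cases k) (auto simp: coeffB coeff_eq_0)
  qed
  then have degB: "degree B = Suc m"
    using leadB by (metis le_antisym le_degree zero_neq_one)
  have nonzero: "poly B z \<noteq> 0" if z: "Im z \<noteq> 0 \<or> Re z > 0" for z
  proof -
    define S where "S = 1 + 1 / z + (\<Sum>k<m. (1 + of_real (r k)) / (z + of_real (r k)))"
    have z0: "z \<noteq> 0" using z by auto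
    have zr: "z + of_real (r k) \<noteq> 0" if "k < m" for k
      using z r[OF that] by (auto simp: complex_eq_iff)
    have Az: "poly A z \<noteq> 0"
      using zr by (auto simp: A_def A poly_prod add.commute)
    \<comment> \<open>The factor \<open>1 - z\<close> of the recurrence has no fixed sign.
      Distributing \<open>m\<close> of the \<open>m + 1\<close> units over the summands replaces it
      by the positive weights \<open>1 + r k\<close>.\<close>
    have "(\<Sum>k<m. (1 + of_real (r k)) / (z + of_real (r k))) =
      (\<Sum>k<m. 1 + (1 - z) * (1 / (z + of_real (r k))))"
      using zr by (intro sum.cong) (auto simp: field_simps)
    also have "\<dots> = of_nat m + (1 - z) * (\<Sum>k<m. 1 / (z + of_real (r k)))"
      by (simp add: sum.distrib sum_distrib_left)
    finally have S: "S = 1 + 1 / z + (of_nat m + (1 - z) * (\<Sum>k<m. 1 / (z + of_real (r k))))"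
      by (simp add: S_def)
    have dA: "poly (pderiv A) z = poly A z * (\<Sum>k<m. 1 / (z + of_real (r k)))"
      unfolding A_def A using zr by (intro poly_pderiv_prod_linear) auto
    have "poly B z = z * poly A z * S"
      using z0 by (simp add: B dA S field_simps)
    moreover have "S \<noteq> 0"
    proof (cases "Im z = 0")
      case True
      then obtain x where x: "z = of_real x" "x > 0"
        using z by (metis complex_is_Real_iff Reals_cases Re_complex_of_real)
      have "S = of_real (1 + 1 / x + (\<Sum>k<m. (1 + r k) / (x + r k)))"
        by (simp add: S_def x(1))
      moreover have "(\<Sum>k<m. (1 + r k) / (x + r k)) \<ge> 0"
        using r x(2) by (intro sum_nonneg divide_nonneg_nonneg) (auto intro: add_nonneg_nonneg)
      then have "1 + 1 / x + (\<Sum>k<m. (1 + r k) / (x + r k)) > 0"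
        using x(2) by (intro add_pos_nonneg) auto
      ultimately show ?thesis by (metis less_irrefl of_real_eq_0_iff)
    next
      case False
      \<comment> \<open>Multiplying by \<open>Im z\<close> treats both half-planes at once. The case
        \<open>a = 0\<close> is the term \<open>1 / z\<close>, which later makes the inequality
        strict even if \<open>m = 0\<close>.\<close>
      have inv: "Im z * Im (1 / (z + of_real a)) < 0" for a
      proof -
        have "(Re (z + of_real a))\<^sup>2 + (Im z)\<^sup>2 > 0"
          using False by (simp add: sum_power2_gt_zero_iff)
        then show ?thesis
          using False by (simp add: Im_divide divide_neg_pos flip: power2_eq_square)
      qed
      have summand: "Im z * Im ((1 + of_real (r k)) / (z + of_real (r k))) \<le> 0" if "k < m" for k
      proof -
        have "(1 + of_real (r k)) / (z + of_real (r k)) =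
            of_real (1 + r k) * (1 / (z + of_real (r k)))"
          by simp
        then have "Im z * Im ((1 + of_real (r k)) / (z + of_real (r k))) =
            (1 + r k) * (Im z * Im (1 / (z + of_real (r k))))"
          by (simp only: Im_complex_of_real times_complex.sel Re_complex_of_real) simp
        also have "\<dots> \<le> 0"
          using inv[of "r k"] r[OF that] by (intro mult_nonneg_nonpos[of "1 + r k"]) auto
        finally show ?thesis .
      qed
      have "Im z * Im S = Im z * Im (1 / z) +
          (\<Sum>k<m. Im z * Im ((1 + of_real (r k)) / (z + of_real (r k))))"
        by (simp only: S_def plus_complex.sel Im_sum one_complex.sel sum_distrib_left
            distrib_left mult_zero_right add_0)
      also have "\<dots> < 0"
        using inv[of 0] summand by (intro add_neg_nonpos sum_nonpos) auto
      finally show ?thesis by auto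
    qed
    ultimately show ?thesis using z0 Az by simp
  qed
  obtain \<rho> where \<rho>: "smult (lead_coeff B) (\<Prod>i<degree B. [:- \<rho> i, 1:]) = B"
    by (rule complex_poly_decompose')
  then have \<rho>: "B = (\<Prod>i<Suc m. [:- \<rho> i, 1:])"
    using leadB by (simp add: degB)
  have root: "Im (\<rho> i) = 0 \<and> Re (\<rho> i) \<le> 0" if "i < Suc m" for i
  proof -
    have "poly B (\<rho> i) = 0"
      unfolding \<rho> poly_prod using that by (intro prod_zero) auto
    then show ?thesis using nonzero[of "\<rho> i"] by force
  qed
  have "B = (\<Prod>i<Suc m. [:complex_of_real (- Re (\<rho> i)), 1:])"
    unfolding \<rho> using root by (intro prod.cong) (auto simp: complex_eq_iff)
  then show ?case
    using root by (intro exI[of _ "\<lambda>i. - Re (\<rho> i)"]) (auto simp: B_def)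
qed simp

section \<open>The generating function by descents and bars\<close>

text \<open>The slots choose independently: a slot with a falling pair contributes \<open>x\<close>
  unbarred or \<open>y\<close> barred, any other slot 1 or \<open>y\<close>. Expanding the product
  over slots gives the sum over bar sets.\<close>

lemma sum_bars:
  fixes x y :: "'a::comm_semiring_1"
  shows "(\<Sum>B\<in>Pow {1..n - 1}. x ^ des n (\<sigma>, B) * y ^ seg (\<sigma>, B)) =
    (x + y) ^ card {i \<in> {1..n - 1}. \<sigma> i > \<sigma> (i + 1)} *
    (1 + y) ^ (n - 1 - card {i \<in> {1..n - 1}. \<sigma> i > \<sigma> (i + 1)})"
proof -
  let ?A = "{1..n - 1}" and ?f = "\<lambda>i. if \<sigma> i > \<sigma> (i + 1) then x else 1"
  have des: "(\<Prod>i\<in>?A - B. ?f i) = x ^ des n (\<sigma>, B)" for B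
  proof -
    have "(\<Prod>i\<in>?A - B. ?f i) = (\<Prod>i\<in>{i \<in> ?A - B. \<sigma> i > \<sigma> (i + 1)}. x)"
      by (rule prod.inter_filter[symmetric]) simp
    also have "{i \<in> ?A - B. \<sigma> i > \<sigma> (i + 1)} = {i \<in> ?A. \<sigma> i > \<sigma> (i + 1) \<and> i \<notin> B}"
      by auto
    finally show ?thesis by (simp add: des_def)
  qed
  have "(\<Sum>B\<in>Pow ?A. x ^ des n (\<sigma>, B) * y ^ seg (\<sigma>, B)) =
    (\<Sum>B\<in>Pow ?A. (\<Prod>i\<in>B. y) * (\<Prod>i\<in>?A - B. ?f i))"
    by (simp only: des) (simp add: seg_def mult.commute)
  also have "\<dots> = (\<Prod>i\<in>?A. y + ?f i)"
    by (rule prod_add[symmetric]) simp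
  also have "\<dots> = (\<Prod>i\<in>?A. if \<sigma> i > \<sigma> (i + 1) then x + y else 1 + y)"
    by (intro prod.cong) (auto simp: add.commute)
  also have "\<dots> = (x + y) ^ card (?A \<inter> {i. \<sigma> i > \<sigma> (i + 1)}) *
    (1 + y) ^ card (?A \<inter> - {i. \<sigma> i > \<sigma> (i + 1)})"
    by (subst prod.If_cases) auto
  also have "?A \<inter> - {i. \<sigma> i > \<sigma> (i + 1)} = ?A - {i \<in> ?A. \<sigma> i > \<sigma> (i + 1)}"
    by auto
  also have "card \<dots> = n - 1 - card {i \<in> ?A. \<sigma> i > \<sigma> (i + 1)}"
    by (subst card_Diff_subset) auto
  also have "?A \<inter> {i. \<sigma> i > \<sigma> (i + 1)} = {i \<in> ?A. \<sigma> i > \<sigma> (i + 1)}"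
    by auto
  finally show ?thesis .
qed

text \<open>Falling pairs number at most \<open>n - 1\<close>, so factoring out
  \<open>(1 + y) ^ (n - 1)\<close> dehomogenises the form given by \<open>sum_bars\<close>.\<close>

lemma sum_SP_eulerian_poly:
  fixes x y :: complex
  assumes y: "1 + y \<noteq> 0"
  shows "(\<Sum>s\<in>SP n. x ^ des n s * y ^ seg s) =
    (1 + y) ^ (n - 1) * poly (eulerian_poly n) ((x + y) / (1 + y))"
proof -
  have SP: "SP n = {\<sigma>. \<sigma> permutes {1..n}} \<times> Pow {1..n - 1}"
    by (auto simp: SP_def)
  have "(\<Sum>s\<in>SP n. x ^ des n s * y ^ seg s) =
    (\<Sum>\<sigma> | \<sigma> permutes {1..n}. \<Sum>B\<in>Pow {1..n - 1}. x ^ des n (\<sigma>, B) * y ^ seg (\<sigma>, B))"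
    unfolding SP by (subst sum.cartesian_product) (simp add: case_prod_unfold)
  also have "\<dots> = (\<Sum>\<sigma> | \<sigma> permutes {1..n}. (1 + y) ^ (n - 1) *
    ((x + y) / (1 + y)) ^ card {i \<in> {1..n - 1}. \<sigma> i > \<sigma> (i + 1)})"
  proof (intro sum.cong refl)
    fix \<sigma> :: "nat \<Rightarrow> nat"
    define d where "d = card {i \<in> {1..n - 1}. \<sigma> i > \<sigma> (i + 1)}"
    have "d \<le> card {1..n - 1}"
      unfolding d_def by (intro card_mono) auto
    then have "(x + y) ^ d * (1 + y) ^ (n - 1 - d) = (1 + y) ^ (n - 1) * ((x + y) / (1 + y)) ^ d"
      using y power_diff[of "1 + y" d "n - 1"] by (simp add: power_divide)
    then show "(\<Sum>B\<in>Pow {1..n - 1}. x ^ des n (\<sigma>, B) * y ^ seg (\<sigma>, B)) =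
        (1 + y) ^ (n - 1) * ((x + y) / (1 + y)) ^ card {i \<in> {1..n - 1}. \<sigma> i > \<sigma> (i + 1)}"
      unfolding sum_bars d_def .
  qed
  finally show ?thesis
    by (simp add: poly_eulerian_poly sum_distrib_left)
qed

text \<open>Each of the \<open>n - 1\<close> linear Eulerian factors absorbs one power of
  \<open>1 + y\<close>, which clears its denominator.\<close>

lemma sum_SP_product:
  assumes "n \<ge> 1"
  obtains r :: "nat \<Rightarrow> real" where "\<And>k. k < n - 1 \<Longrightarrow> r k \<ge> 0"
    "\<And>x y :: complex. 1 + y \<noteq> 0 \<Longrightarrow>
      (\<Sum>s\<in>SP n. x ^ des n s * y ^ seg s) = (\<Prod>k<n - 1. x + y + of_real (r k) * (1 + y))"
proof -
  obtain r where r: "\<forall>k<n - 1. r k \<ge> 0"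
    "eulerian_poly n = (\<Prod>k<n - 1. [:complex_of_real (r k), 1:])"
    using eulerian_poly_real_zeros[of "n - 1"] assms by auto
  have "(\<Sum>s\<in>SP n. x ^ des n s * y ^ seg s) = (\<Prod>k<n - 1. x + y + of_real (r k) * (1 + y))"
    if y: "1 + y \<noteq> 0" for x y :: complex
  proof -
    have "(\<Sum>s\<in>SP n. x ^ des n s * y ^ seg s) =
      (\<Prod>k<n - 1. (1 + y) * (of_real (r k) + (x + y) / (1 + y)))"
      unfolding sum_SP_eulerian_poly[OF y] r(2) by (simp add: poly_prod prod.distrib)
    also have "\<dots> = (\<Prod>k<n - 1. x + y + of_real (r k) * (1 + y))"
      using y by (intro prod.cong) (simp_all add: field_simps)
    finally show ?thesis .
  qed
  then show thesis using that r(1) by blast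
qed

text \<open>Descents and bars occupy disjoint sets of slots. Hence the truncated ranges defining
  \<open>P_poly\<close>, \<open>K_poly\<close> and \<open>L_poly\<close> lose no terms.\<close>

lemma des_seg_le:
  assumes "s \<in> SP n"
  shows "des n s + seg s \<le> n - 1"
proof -
  have B: "snd s \<subseteq> {1..n - 1}" using assms by (auto simp: SP_def)
  then have "finite (snd s)" by (rule finite_subset) simp
  then have "des n s + seg s =
    card ({i \<in> {1..n - 1}. fst s i > fst s (i + 1) \<and> i \<notin> snd s} \<union> snd s)"
    unfolding des_def seg_def by (subst card_Un_disjoint) auto
  also have "\<dots> \<le> card {1..n - 1}"
    using B by (intro card_mono) auto
  finally show ?thesis by simp
qed

section \<open>Complex values of the three polynomials\<close>

lemma sum_power_statistic:
  fixes z :: "'a::comm_semiring_1"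
  assumes "finite S" "f ` S \<subseteq> {0..m}"
  shows "(\<Sum>i = 0..m. of_nat (card {s \<in> S. f s = i}) * z ^ i) = (\<Sum>s\<in>S. z ^ f s)"
proof -
  have "(\<Sum>s\<in>S. z ^ f s) = (\<Sum>i = 0..m. \<Sum>s | s \<in> S \<and> f s = i. z ^ f s)"
    using assms by (intro sum.group[symmetric]) auto
  then show ?thesis by simp
qed

lemma poly_of_real_sum_monom:
  "poly (map_poly of_real (\<Sum>i\<in>A. monom (of_nat (a i)) i)) (z :: complex) =
     (\<Sum>i\<in>A. of_nat (a i) * z ^ i)"
proof -
  have "map_poly of_real (\<Sum>i\<in>A. monom (of_nat (a i)) i) =
      (\<Sum>i\<in>A. monom (of_nat (a i) :: complex) i)"
    by (rule poly_eqI) (auto simp: coeff_map_poly coeff_sum intro!: sum.cong)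
  then show ?thesis by (simp add: poly_sum poly_monom)
qed

lemma poly_P_poly: "poly (map_poly of_real (P_poly n)) (z :: complex) = (\<Sum>s\<in>SP n. z ^ des n s)"
  unfolding P_poly_def poly_of_real_sum_monom T_def
  using des_seg_le by (intro sum_power_statistic finite_SP) fastforce

text \<open>With the descent variable fixed at \<open>z\<close>, the value becomes a coefficient in
  the bar variable, the form that \<open>coeff_prod_linear_nonzero\<close> handles.\<close>

lemma poly_K_poly:
  "poly (map_poly of_real (K_poly n j)) (z :: complex) =
     coeff (\<Sum>s\<in>SP n. monom (z ^ des n s) (seg s)) j"
proof -
  have "poly (map_poly of_real (K_poly n j)) z = (\<Sum>s | s \<in> SP n \<and> seg s = j. z ^ des n s)"
    unfolding K_poly_def poly_of_real_sum_monom K_def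
    using sum_power_statistic[of "{s \<in> SP n. seg s = j}" "des n" "n - 1 - j" z] des_seg_le[of _ n]
    by (force simp: finite_SP conj_ac)
  then show ?thesis
    by (simp add: coeff_sum sum.inter_filter finite_SP)
qed

lemma poly_L_poly:
  "poly (map_poly of_real (L_poly n i)) (z :: complex) =
     coeff (\<Sum>s\<in>SP n. monom (z ^ seg s) (des n s)) i"
proof -
  have "poly (map_poly of_real (L_poly n i)) z = (\<Sum>s | s \<in> SP n \<and> des n s = i. z ^ seg s)"
    unfolding L_poly_def poly_of_real_sum_monom K_def
    using sum_power_statistic[of "{s \<in> SP n. des n s = i}" seg "n - 1 - i" z] des_seg_le[of _ n]
    by (force simp: finite_SP conj_ac)
  then show ?thesis
    by (simp add: coeff_sum sum.inter_filter finite_SP)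
qed

section \<open>Real zeros of the three families\<close>

text \<open>The coefficients are real, so conjugation carries a zero in the lower half-plane to one
  in the upper.\<close>

lemma only_real_zerosI:
  assumes "\<And>z::complex. Im z > 0 \<Longrightarrow> poly (map_poly of_real p) z \<noteq> 0"
  shows "only_real_zeros p"
  unfolding only_real_zeros_def
proof (intro allI impI)
  fix z :: complex assume z: "poly (map_poly of_real p) z = 0"
  then have "poly (map_poly of_real p) (cnj z) = 0"
    by (subst real_poly_cnj_root_iff) (auto simp: coeff_map_poly)
  with z assms[of z] assms[of "cnj z"] show "z \<in> \<real>"
    by (auto simp: complex_is_Real_iff) (meson linorder_neqE_linordered_idom)
qed

theorem theorem1p2:
  fixes n :: nat
  assumes "n \<ge> 1"
  shows "\<forall>i j. i \<le> n - 1 \<longrightarrow> j \<le> n - 1 \<longrightarrow>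
    only_real_zeros (P_poly n) \<and> only_real_zeros (K_poly n j) \<and> only_real_zeros (L_poly n i)"
proof (intro allI impI conjI)
  obtain r :: "nat \<Rightarrow> real" where r: "\<And>k. k < n - 1 \<Longrightarrow> r k \<ge> 0"
    and prod: "\<And>x y :: complex. 1 + y \<noteq> 0 \<Longrightarrow>
      (\<Sum>s\<in>SP n. x ^ des n s * y ^ seg s) = (\<Prod>k<n - 1. x + y + of_real (r k) * (1 + y))"
    using sum_SP_product[OF assms] by blast
  fix i j assume i: "i \<le> n - 1" and j: "j \<le> n - 1"
  show "only_real_zeros (P_poly n)"
  proof (rule only_real_zerosI)
    fix z :: complex assume z: "Im z > 0"
    have "poly (map_poly of_real (P_poly n)) z = (\<Prod>k<n - 1. z + 1 + of_real (r k) * 2)"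
      using prod[of 1 z] by (simp add: poly_P_poly)
    moreover have "z + 1 + of_real (r k) * 2 \<noteq> 0" for k
      using z by (auto simp: complex_eq_iff)
    ultimately show "poly (map_poly of_real (P_poly n)) z \<noteq> 0" by simp
  qed
  show "only_real_zeros (K_poly n j)"
  proof (rule only_real_zerosI)
    fix z :: complex assume z: "Im z > 0"
    let ?p = "\<Sum>s\<in>SP n. monom (z ^ des n s) (seg s)"
    let ?q = "\<Prod>k<n - 1. [:z + of_real (r k), of_real (1 + r k):]"
    \<comment> \<open>The product formula is available only for \<open>1 + y \<noteq> 0\<close>.
      After multiplication by \<open>[:1, 1:]\<close> both sides also agree at -1, and the factor is
      cancelled as a polynomial.\<close>
    have "poly (?p * [:1, 1:]) y = poly (?q * [:1, 1:]) y" for y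
    proof (cases "1 + y = 0")
      case False
      have "poly ?p y = poly ?q y"
        using prod[OF False, of z] by (simp add: poly_sum poly_prod poly_monom algebra_simps)
      then show ?thesis by simp
    next
      case True
      then have "poly [:1, 1:] y = 0" by simp
      then show ?thesis by (simp only: poly_mult mult_zero_right)
    qed
    then have "?p * [:1, 1:] = ?q * [:1, 1:]"
      using poly_eq_poly_eq_iff by blast
    then have "?p = ?q"
      by (subst (asm) mult_cancel_right) simp
    moreover have "coeff ?q j \<noteq> 0"
      using z r j by (intro coeff_prod_linear_nonzero) (auto intro: add_pos_nonneg)
    ultimately show "poly (map_poly of_real (K_poly n j)) z \<noteq> 0"
      by (simp only: poly_K_poly not_False_eq_True)
  qed
  show "only_real_zeros (L_poly n i)"
  proof (rule only_real_zerosI)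
    fix z :: complex assume z: "Im z > 0"
    let ?p = "\<Sum>s\<in>SP n. monom (z ^ seg s) (des n s)"
    \<comment> \<open>The constant terms have imaginary part \<open>(1 + r k) * Im z\<close>, which
      is positive. The slope is written \<open>of_real 1\<close> to fit
      \<open>coeff_prod_linear_nonzero\<close>.\<close>
    let ?q = "\<Prod>k<n - 1. [:z + of_real (r k) * (1 + z), of_real 1:]"
    have "1 + z \<noteq> 0" using z by (auto simp: complex_eq_iff)
    then have "poly ?p x = poly ?q x" for x
      using prod[of z x] by (simp add: poly_sum poly_prod poly_monom algebra_simps)
    then have "?p = ?q"
      using poly_eq_poly_eq_iff by blast
    moreover have "coeff ?q i \<noteq> 0"
      using z r i by (intro coeff_prod_linear_nonzero) (auto intro: add_pos_nonneg)
    ultimately show "poly (map_poly of_real (L_poly n i)) z \<noteq> 0"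
      by (simp only: poly_L_poly not_False_eq_True)
  qed
qed

end
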